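(* Let $a,T>0$, $\Omega=(0,a)^3$, $Q=\Omega\times(0,T)$, $\nu_0,\alpha_2>0$, and let $\{\boldsymbol u,\omega,k\}$ and $\mu\in\mathcal M_\ge(\overline Q)$ be a weak solution with defect measure in the sense defined in the context, for data $\boldsymbol f,\boldsymbol u_0,\omega_0,k_0$. Assume in addition that for all $t\in[0,T]$ the energy equality $$\int_\Omega\Big(\frac12|\boldsymbol u(x,t)|^2+k(x,t)\Big)\mathrm dx+\alpha_2\int_0^t\!\!\int_\Omega k\omega\,\mathrm dx\,\mathrm ds=\int_\Omega\Big(\frac12|\boldsymbol u_0(x)|^2+k_0(x)\Big)\mathrm dx+\int_0^t\!\!\int_\Omega\boldsymbol f\cdot\boldsymbol u\,\mathrm dx\,\mathrm ds$$ holds. Then the following two statements are equivalent: (i) $\mu=0$; (ii) for a.a. $t\in[0,T]$, $$\int_\Omega\frac12|\boldsymbol u(x,t)|^2\mathrm dx+\nu_0\int_0^t\!\!\int_\Omega\frac k\omega|\boldsymbol D(\boldsymbol u)|^2\mathrm dx\,\mathrm ds=\frac12\int_\Omega|\boldsymbol u_0(x)|^2\mathrm dx+\int_0^t\!\!\int_\Omega\boldsymbol f\cdot\boldsymbol u\,\mathrm dx\,\mathrm ds.$$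
   Context: Setting. $\Omega=(0,a)^3$, $Q=\Omega\times(0,T)$, $\Gamma_i=\partial\Omega\cap\{x_i=0\}$, $\Gamma_{i+3}=\partial\Omega\cap\{x_i=a\}$ for $i=1,2,3$. Bold letters denote vector-valued functions and spaces of such functions. $\boldsymbol D(\boldsymbol u)=\frac12(\nabla\boldsymbol u+(\nabla\boldsymbol u)^\top)$. Function spaces (opposite faces identified by translation): $W^{1,p}_{\mathrm{per}}(\Omega)=\{u\in W^{1,p}(\Omega): u|_{\Gamma_i}=u|_{\Gamma_{i+3}},\ i=1,2,3\}$; $\boldsymbol W^{1,p}_{\mathrm{per},\mathrm{div}}(\Omega)$ is the set of vector fields with components in $W^{1,p}_{\mathrm{per}}(\Omega)$ and zero divergence a.e.; $C^1_{\mathrm{per},T}(\overline Q)$: all $\varphi\in C^1(\overline Q)$ with $\varphi,\nabla\varphi$ taking equal values on $\Gamma_i\times(0,T)$ and $\Gamma_{i+3}\times(0,T)$ and $\varphi(x,T)=0$ for all $x\in\Omega$; $\boldsymbol C^1_{\mathrm{per},T,\mathrm{div}}(\overline Q)$: divergence-free vector fields with components in $C^1_{\mathrm{per},T}(\overline Q)$; $\mathcal M_{\ge}(\overline Q)$: non-negative bounded Radon measures on $\overline Q$. Definition (weak solution with defect measure). Let $\boldsymbol f\in\boldsymbol L^1(Q)$, $\boldsymbol u_0\in\boldsymbol L^1(\Omega)$, $\omega_0,k_0\in L^1(\Omega)$ with $\omega_0,k_0\ge0$ a.e. A triple of measurable functions $\{\boldsymbol u,\omega,k\}$ in $Q$ is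 a weak solution with defect measure $\mu\in\mathcal M_\ge(\overline Q)$ if: (a) $\omega>0$ and $\frac k\omega\ge\mathrm{const}>0$ a.e. in $Q$; (b) $\boldsymbol u\in L^\infty(0,T;\boldsymbol L^2(\Omega))\cap L^2(0,T;\boldsymbol W^{1,2}_{\mathrm{per},\mathrm{div}}(\Omega))$, $\omega\in L^\infty(0,T;L^2(\Omega))\cap L^2(0,T;W^{1,2}_{\mathrm{per}}(\Omega))$, $k\in L^\infty(0,T;L^1(\Omega))\cap L^{15/14}(0,T;W^{1,15/14}_{\mathrm{per}}(\Omega))$; (c) $\int_Q\frac k\omega\big((1+|\boldsymbol D(\boldsymbol u)|)|\boldsymbol D(\boldsymbol u)|+|\nabla\omega|+|\nabla k|\big)\mathrm dx\,\mathrm dt<\infty$; (d) for all $\boldsymbol v\in\boldsymbol C^1_{\mathrm{per},T,\mathrm{div}}(\overline Q)$: $-\int_Q\boldsymbol u\cdot\partial_t\boldsymbol v-\int_Q(\boldsymbol u\otimes\boldsymbol u):\nabla\boldsymbol v+\nu_0\int_Q\frac k\omega\boldsymbol D(\boldsymbol u):\boldsymbol D(\boldsymbol v)=\int_\Omega\boldsymbol u_0\cdot\boldsymbol v(\cdot,0)+\int_Q\boldsymbol f\cdot\boldsymbol v$; (e) for all $\varphi\in C^1_{\mathrm{per},T}(\overline Q)$: $-\int_Q\omega\,\partial_t\varphi-\int_Q\omega\boldsymbol u\cdot\nabla\varphi+\int_Q\frac k\omega\nabla\omega\cdot\nabla\varphi=\int_\Omega\omega_0\varphi(\cdot,0)-\int_Q\omega^2\varphi$;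 (f) for all $z\in C^1_{\mathrm{per},T}(\overline Q)$: $-\int_Qk\,\partial_tz-\int_Qk\boldsymbol u\cdot\nabla z+\int_Q\frac k\omega\nabla k\cdot\nabla z=\int_\Omega k_0z(\cdot,0)+\int_Q\big(\nu_0\frac k\omega|\boldsymbol D(\boldsymbol u)|^2-\alpha_2k\omega\big)z+\int_{\overline Q}z\,\mathrm d\mu$; (g) for a.a. $t\in[0,T]$: $\int_\Omega\frac12|\boldsymbol u(x,t)|^2\mathrm dx+\int_0^t\!\int_\Omega\nu_0\frac k\omega|\boldsymbol D(\boldsymbol u)|^2\mathrm dx\,\mathrm ds\le\int_\Omega\frac12|\boldsymbol u_0|^2\mathrm dx+\int_0^t\!\int_\Omega\boldsymbol f\cdot\boldsymbol u\,\mathrm dx\,\mathrm ds$; (h) for a.a. $t\in[0,T]$: $\int_\Omega\big(\frac12|\boldsymbol u(x,t)|^2+k(x,t)\big)\mathrm dx+\int_0^t\!\int_\Omega\alpha_2k\omega\,\mathrm dx\,\mathrm ds\le\int_\Omega\big(\frac12|\boldsymbol u_0|^2+k_0\big)\mathrm dx+\int_0^t\!\int_\Omega\boldsymbol f\cdot\boldsymbol u\,\mathrm dx\,\mathrm ds$.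
   Formalization: Test functions vanish at t=T, so mass of μ on {t=T} is invisible and (ii)⇒(i) fails as stated; proved instead: for every μ, (ii) holds iff μ vanishes on the part t<T of the closed cylinder, and μ=0 iff (ii) when μ does not charge {t=T}. *)

theory Defs
  imports "HOL-Analysis.Analysis"
begin

type_synonym space_time = "(real^3) \<times> real"

definition cube :: "real \<Rightarrow> (real^3) set" where
  "cube a = {x. \<forall>i. 0 < x $ i \<and> x $ i < a}"

definition cyl :: "real \<Rightarrow> real \<Rightarrow> space_time set" where
  "cyl a T = cube a \<times> {0<..<T}"

definition face :: "real \<Rightarrow> 3 \<Rightarrow> real \<Rightarrow> (real^3) set" where
  "face a i c = frontier (cube a) \<inter> {x. x $ i = c}"


section \<open>Classical differentiability\<close>

(* S is meant to be open or a nondegenerate closed box, so that the derivative within S is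
   unique at every point of S. For a closed box this is the usual space C^n up to the boundary. *)
primrec Ck_on :: "nat \<Rightarrow> 'a::euclidean_space set \<Rightarrow> ('a \<Rightarrow> real) \<Rightarrow> bool" where
  "Ck_on 0 S = (\<lambda>f. continuous_on S f)"
| "Ck_on (Suc n) S = (\<lambda>f. f differentiable_on S \<and>
     (\<forall>e\<in>Basis. Ck_on n S (\<lambda>x. frechet_derivative f (at x within S) e)))"

definition test_fun :: "(real^3) set \<Rightarrow> (real^3 \<Rightarrow> real) \<Rightarrow> bool" where
  "test_fun \<Omega> \<phi> \<longleftrightarrow> (\<forall>n. Ck_on n UNIV \<phi>) \<and>
     compact (closure {x. \<phi> x \<noteq> 0}) \<and> closure {x. \<phi> x \<noteq> 0} \<subseteq> \<Omega>"


section \<open>Lebesgue and Sobolev spaces\<close>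

definition Lp_on :: "'a::euclidean_space set \<Rightarrow> real \<Rightarrow> ('a \<Rightarrow> 'b::euclidean_space) \<Rightarrow> bool" where
  "Lp_on S p f \<longleftrightarrow> f \<in> borel_measurable (lebesgue_on S) \<and>
     integrable (lebesgue_on S) (\<lambda>x. norm (f x) powr p)"

definition Lp_norm :: "'a::euclidean_space set \<Rightarrow> real \<Rightarrow> ('a \<Rightarrow> 'b::euclidean_space) \<Rightarrow> real" where
  "Lp_norm S p f = (LINT x|lebesgue_on S. norm (f x) powr p) powr (1 / p)"

definition loc_integrable :: "'a::euclidean_space set \<Rightarrow> ('a \<Rightarrow> 'b::euclidean_space) \<Rightarrow> bool" where
  "loc_integrable \<Omega> f \<longleftrightarrow> (\<forall>K. compact K \<and> K \<subseteq> \<Omega> \<longrightarrow> integrable (lebesgue_on K) f)"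

definition weak_gradient :: "(real^3) set \<Rightarrow> (real^3 \<Rightarrow> real) \<Rightarrow> (real^3 \<Rightarrow> real^3) \<Rightarrow> bool" where
  "weak_gradient \<Omega> v g \<longleftrightarrow> loc_integrable \<Omega> v \<and> loc_integrable \<Omega> g \<and>
     (\<forall>\<phi> i. test_fun \<Omega> \<phi> \<longrightarrow>
        (LINT x|lebesgue_on \<Omega>. v x * frechet_derivative \<phi> (at x) (axis i 1))
        = - (LINT x|lebesgue_on \<Omega>. g x $ i * \<phi> x))"

(* A weak gradient is unique up to a null set; this picks a version. *)
definition wgrad :: "(real^3) set \<Rightarrow> (real^3 \<Rightarrow> real) \<Rightarrow> real^3 \<Rightarrow> real^3" where
  "wgrad \<Omega> v = (SOME g. weak_gradient \<Omega> v g)"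

definition W1p :: "(real^3) set \<Rightarrow> real \<Rightarrow> (real^3 \<Rightarrow> real) \<Rightarrow> bool" where
  "W1p \<Omega> p v \<longleftrightarrow> Lp_on \<Omega> p v \<and> (\<exists>g. weak_gradient \<Omega> v g \<and> Lp_on \<Omega> p g)"

definition W1p_norm :: "(real^3) set \<Rightarrow> real \<Rightarrow> (real^3 \<Rightarrow> real) \<Rightarrow> real" where
  "W1p_norm \<Omega> p v = Lp_norm \<Omega> p v + Lp_norm \<Omega> p (wgrad \<Omega> v)"

(* Isometric parametrisation of the plane x_i = c by R^2; addition of indices in type 3 is
   modulo 3. Since it depends on c only in the i-th coordinate, opposite faces carry coordinates
   that correspond to each other under the translation identifying these faces. *)
definition face_pt :: "3 \<Rightarrow> real \<Rightarrow> real^2 \<Rightarrow> real^3" where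
  "face_pt i c y = (\<chi> j. if j = i then c else if j = i + 1 then y $ 1 else y $ 2)"

definition square :: "real \<Rightarrow> (real^2) set" where
  "square a = {y. \<forall>i. 0 < y $ i \<and> y $ i < a}"

(* g is, in the coordinates face_pt i c, the trace of v on the face x_i = c (c = 0 or c = a):
   the trace operator is the continuous extension of the restriction map from C^1 up to the
   boundary (dense in W^{1,p}) to a map from W^{1,p} into L^p of the face. *)
definition face_trace ::
    "real \<Rightarrow> real \<Rightarrow> 3 \<Rightarrow> real \<Rightarrow> (real^3 \<Rightarrow> real) \<Rightarrow> (real^2 \<Rightarrow> real) \<Rightarrow> bool" where
  "face_trace a p i c v g \<longleftrightarrow> Lp_on (square a) p g \<and>
     (\<exists>V :: nat \<Rightarrow> real^3 \<Rightarrow> real.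
        (\<forall>n. Ck_on 1 (closure (cube a)) (V n)) \<and>
        (\<lambda>n. W1p_norm (cube a) p (\<lambda>x. V n x - v x)) \<longlonglongrightarrow> 0 \<and>
        (\<lambda>n. Lp_norm (square a) p (\<lambda>y. V n (face_pt i c y) - g y)) \<longlonglongrightarrow> 0)"

definition W1p_per :: "real \<Rightarrow> real \<Rightarrow> (real^3 \<Rightarrow> real) \<Rightarrow> bool" where
  "W1p_per a p v \<longleftrightarrow> W1p (cube a) p v \<and>
     (\<forall>i. \<exists>g. face_trace a p i 0 v g \<and> face_trace a p i a v g)"

definition W1p_per_div :: "real \<Rightarrow> real \<Rightarrow> (real^3 \<Rightarrow> real^3) \<Rightarrow> bool" where
  "W1p_per_div a p v \<longleftrightarrow> (\<forall>i. W1p_per a p (\<lambda>x. v x $ i)) \<and>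
     (AE x in lebesgue_on (cube a). (\<Sum>i\<in>UNIV. wgrad (cube a) (\<lambda>y. v y $ i) x $ i) = 0)"


section \<open>Spaces of functions on the space-time cylinder\<close>

definition Linf_Lp :: "real \<Rightarrow> real \<Rightarrow> real \<Rightarrow> (space_time \<Rightarrow> 'b::euclidean_space) \<Rightarrow> bool" where
  "Linf_Lp a T p w \<longleftrightarrow> w \<in> borel_measurable (lebesgue_on (cyl a T)) \<and>
     (\<exists>C. AE t in lebesgue_on {0<..<T}.
        Lp_on (cube a) p (\<lambda>x. w (x, t)) \<and> Lp_norm (cube a) p (\<lambda>x. w (x, t)) \<le> C)"

definition spatial_gradient ::
    "real \<Rightarrow> real \<Rightarrow> (space_time \<Rightarrow> real) \<Rightarrow> (space_time \<Rightarrow> real^3) \<Rightarrow> bool" where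
  "spatial_gradient a T w G \<longleftrightarrow> G \<in> borel_measurable (lebesgue_on (cyl a T)) \<and>
     (AE t in lebesgue_on {0<..<T}. weak_gradient (cube a) (\<lambda>x. w (x, t)) (\<lambda>x. G (x, t)))"

(* A jointly measurable version of the weak gradient in x, unique up to a null set of the
   cylinder. Choosing wgrad slice by slice would not give a measurable function. *)
definition sgrad :: "real \<Rightarrow> real \<Rightarrow> (space_time \<Rightarrow> real) \<Rightarrow> space_time \<Rightarrow> real^3" where
  "sgrad a T w = (SOME G. spatial_gradient a T w G)"

definition sjac :: "real \<Rightarrow> real \<Rightarrow> (space_time \<Rightarrow> real^3) \<Rightarrow> space_time \<Rightarrow> real^3^3" where
  "sjac a T u z = (\<chi> i. sgrad a T (\<lambda>y. u y $ i) z)"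

definition sym_part :: "real^3^3 \<Rightarrow> real^3^3" where
  "sym_part A = (1/2) *\<^sub>R (A + transpose A)"

definition strain :: "real \<Rightarrow> real \<Rightarrow> (space_time \<Rightarrow> real^3) \<Rightarrow> space_time \<Rightarrow> real^3^3" where
  "strain a T u z = sym_part (sjac a T u z)"

(* The Bochner spaces L^q(0,T; W^{1,p}_per) and L^q(0,T; W^{1,p}_per,div). The joint
   measurability of w and of its spatial gradient expresses that t \<mapsto> w(.,t) is strongly
   measurable with values in the separable space W^{1,p}. *)
definition Lq_W1p_per :: "real \<Rightarrow> real \<Rightarrow> real \<Rightarrow> real \<Rightarrow> (space_time \<Rightarrow> real) \<Rightarrow> bool" where
  "Lq_W1p_per a T q p w \<longleftrightarrow>
     w \<in> borel_measurable (lebesgue_on (cyl a T)) \<and> (\<exists>G. spatial_gradient a T w G) \<and>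
     (AE t in lebesgue_on {0<..<T}. W1p_per a p (\<lambda>x. w (x, t))) \<and>
     Lp_on {0<..<T} q (\<lambda>t. W1p_norm (cube a) p (\<lambda>x. w (x, t)))"

definition Lq_W1p_per_div :: "real \<Rightarrow> real \<Rightarrow> real \<Rightarrow> real \<Rightarrow> (space_time \<Rightarrow> real^3) \<Rightarrow> bool" where
  "Lq_W1p_per_div a T q p u \<longleftrightarrow> (\<forall>i. Lq_W1p_per a T q p (\<lambda>z. u z $ i)) \<and>
     (AE t in lebesgue_on {0<..<T}. W1p_per_div a p (\<lambda>x. u (x, t)))"


section \<open>Test functions on the closed cylinder\<close>

(* Classical partial derivatives on the closed cylinder (one-sided on its boundary). *)
definition dt :: "real \<Rightarrow> real \<Rightarrow> (space_time \<Rightarrow> real) \<Rightarrow> space_time \<Rightarrow> real" where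
  "dt a T \<phi> z = frechet_derivative \<phi> (at z within closure (cyl a T)) (0, 1)"

definition grad :: "real \<Rightarrow> real \<Rightarrow> (space_time \<Rightarrow> real) \<Rightarrow> space_time \<Rightarrow> real^3" where
  "grad a T \<phi> z = (\<chi> i. frechet_derivative \<phi> (at z within closure (cyl a T)) (axis i 1, 0))"

definition dt_vec :: "real \<Rightarrow> real \<Rightarrow> (space_time \<Rightarrow> real^3) \<Rightarrow> space_time \<Rightarrow> real^3" where
  "dt_vec a T v z = (\<chi> i. dt a T (\<lambda>y. v y $ i) z)"

definition jac :: "real \<Rightarrow> real \<Rightarrow> (space_time \<Rightarrow> real^3) \<Rightarrow> space_time \<Rightarrow> real^3^3" where
  "jac a T v z = (\<chi> i. grad a T (\<lambda>y. v y $ i) z)"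

definition C1_per_T :: "real \<Rightarrow> real \<Rightarrow> (space_time \<Rightarrow> real) \<Rightarrow> bool" where
  "C1_per_T a T \<phi> \<longleftrightarrow> Ck_on 1 (closure (cyl a T)) \<phi> \<and>
     (\<forall>i. \<forall>x\<in>face a i 0. \<forall>x'\<in>face a i a. \<forall>t\<in>{0<..<T}. x' = x + axis i a \<longrightarrow>
        \<phi> (x, t) = \<phi> (x', t) \<and> grad a T \<phi> (x, t) = grad a T \<phi> (x', t)) \<and>
     (\<forall>x\<in>cube a. \<phi> (x, T) = 0)"

definition C1_per_T_div :: "real \<Rightarrow> real \<Rightarrow> (space_time \<Rightarrow> real^3) \<Rightarrow> bool" where
  "C1_per_T_div a T v \<longleftrightarrow> (\<forall>i. C1_per_T a T (\<lambda>z. v z $ i)) \<and>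
     (\<forall>z\<in>cyl a T. (\<Sum>i\<in>UNIV. jac a T v z $ i $ i) = 0)"


section \<open>Weak solutions with defect measure\<close>

(* A finite Borel measure on a compact metric space is automatically Radon. *)
definition nonneg_radon_measure :: "real \<Rightarrow> real \<Rightarrow> space_time measure \<Rightarrow> bool" where
  "nonneg_radon_measure a T \<mu> \<longleftrightarrow>
     sets \<mu> = sets (restrict_space borel (closure (cyl a T))) \<and> finite_measure \<mu>"

definition tensor :: "real^3 \<Rightarrow> real^3 \<Rightarrow> real^3^3" where
  "tensor x y = (\<chi> i j. x $ i * y $ j)"

definition admissible_data ::
    "real \<Rightarrow> real \<Rightarrow> (space_time \<Rightarrow> real^3) \<Rightarrow> (real^3 \<Rightarrow> real^3) \<Rightarrow> (real^3 \<Rightarrow> real) \<Rightarrow> (real^3 \<Rightarrow> real) \<Rightarrow> bool"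
  where
  "admissible_data a T f u0 \<omega>0 k0 \<longleftrightarrow>
     Lp_on (cyl a T) 1 f \<and> Lp_on (cube a) 1 u0 \<and> Lp_on (cube a) 1 \<omega>0 \<and> Lp_on (cube a) 1 k0 \<and>
     (AE x in lebesgue_on (cube a). \<omega>0 x \<ge> 0 \<and> k0 x \<ge> 0)"

(* The parameters are a T nu_0 alpha_2, the data f u_0 omega_0 k_0, the triple u omega k and the
   defect measure. On matrices, inner product and norm are the Frobenius ones.

   The three integrability conditions before the energy inequalities say that the integrals
   occurring there exist as finite numbers, which the inequalities presuppose (the integral of a
   non-integrable function is 0 in HOL). The one on k * omega is in addition a consequence of the
   regularity required of k and omega, by the Sobolev inequality and interpolation; the other
   integrands are integrable by the earlier conditions. *)
definition weak_solution_defect ::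
    "real \<Rightarrow> real \<Rightarrow> real \<Rightarrow> real \<Rightarrow>
     (space_time \<Rightarrow> real^3) \<Rightarrow> (real^3 \<Rightarrow> real^3) \<Rightarrow> (real^3 \<Rightarrow> real) \<Rightarrow> (real^3 \<Rightarrow> real) \<Rightarrow>
     (space_time \<Rightarrow> real^3) \<Rightarrow> (space_time \<Rightarrow> real) \<Rightarrow> (space_time \<Rightarrow> real) \<Rightarrow>
     space_time measure \<Rightarrow> bool"
  where
  "weak_solution_defect a T \<nu>0 \<alpha>2 f u0 \<omega>0 k0 u \<omega> k \<mu> \<longleftrightarrow>
     admissible_data a T f u0 \<omega>0 k0 \<and> nonneg_radon_measure a T \<mu> \<and>
     u \<in> borel_measurable (lebesgue_on (cyl a T)) \<and>
     \<omega> \<in> borel_measurable (lebesgue_on (cyl a T)) \<and>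
     k \<in> borel_measurable (lebesgue_on (cyl a T)) \<and>
     (\<exists>c>0. AE z in lebesgue_on (cyl a T). \<omega> z > 0 \<and> k z / \<omega> z \<ge> c) \<and>
     Linf_Lp a T 2 u \<and> Lq_W1p_per_div a T 2 2 u \<and>
     Linf_Lp a T 2 \<omega> \<and> Lq_W1p_per a T 2 2 \<omega> \<and>
     Linf_Lp a T 1 k \<and> Lq_W1p_per a T (15/14) (15/14) k \<and>
     integrable (lebesgue_on (cyl a T)) (\<lambda>z. k z / \<omega> z *
        ((1 + norm (strain a T u z)) * norm (strain a T u z)
          + norm (sgrad a T \<omega> z) + norm (sgrad a T k z))) \<and>
     (\<forall>v. C1_per_T_div a T v \<longrightarrow>
        - (LINT z|lebesgue_on (cyl a T). u z \<bullet> dt_vec a T v z)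
        - (LINT z|lebesgue_on (cyl a T). tensor (u z) (u z) \<bullet> jac a T v z)
        + \<nu>0 * (LINT z|lebesgue_on (cyl a T).
                   k z / \<omega> z * (strain a T u z \<bullet> sym_part (jac a T v z)))
        = (LINT x|lebesgue_on (cube a). u0 x \<bullet> v (x, 0))
          + (LINT z|lebesgue_on (cyl a T). f z \<bullet> v z)) \<and>
     (\<forall>\<phi>. C1_per_T a T \<phi> \<longrightarrow>
        - (LINT z|lebesgue_on (cyl a T). \<omega> z * dt a T \<phi> z)
        - (LINT z|lebesgue_on (cyl a T). \<omega> z * (u z \<bullet> grad a T \<phi> z))
        + (LINT z|lebesgue_on (cyl a T). k z / \<omega> z * (sgrad a T \<omega> z \<bullet> grad a T \<phi> z))
        = (LINT x|lebesgue_on (cube a). \<omega>0 x * \<phi> (x, 0))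
          - (LINT z|lebesgue_on (cyl a T). (\<omega> z)\<^sup>2 * \<phi> z)) \<and>
     (\<forall>\<zeta>. C1_per_T a T \<zeta> \<longrightarrow>
        - (LINT z|lebesgue_on (cyl a T). k z * dt a T \<zeta> z)
        - (LINT z|lebesgue_on (cyl a T). k z * (u z \<bullet> grad a T \<zeta> z))
        + (LINT z|lebesgue_on (cyl a T). k z / \<omega> z * (sgrad a T k z \<bullet> grad a T \<zeta> z))
        = (LINT x|lebesgue_on (cube a). k0 x * \<zeta> (x, 0))
          + (LINT z|lebesgue_on (cyl a T).
               (\<nu>0 * (k z / \<omega> z) * (norm (strain a T u z))\<^sup>2 - \<alpha>2 * k z * \<omega> z) * \<zeta> z)
          + (LINT z|\<mu>. \<zeta> z)) \<and>
     integrable (lebesgue_on (cube a)) (\<lambda>x. (norm (u0 x))\<^sup>2) \<and>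
     integrable (lebesgue_on (cyl a T)) (\<lambda>z. f z \<bullet> u z) \<and>
     integrable (lebesgue_on (cyl a T)) (\<lambda>z. k z * \<omega> z) \<and>
     (AE t in lebesgue_on {0..T}.
        (LINT x|lebesgue_on (cube a). 1/2 * (norm (u (x, t)))\<^sup>2)
        + (LINT s|lebesgue_on {0<..<t}. LINT x|lebesgue_on (cube a).
             \<nu>0 * (k (x, s) / \<omega> (x, s)) * (norm (strain a T u (x, s)))\<^sup>2)
        \<le> (LINT x|lebesgue_on (cube a). 1/2 * (norm (u0 x))\<^sup>2)
          + (LINT s|lebesgue_on {0<..<t}. LINT x|lebesgue_on (cube a). f (x, s) \<bullet> u (x, s))) \<and>
     (AE t in lebesgue_on {0..T}.
        (LINT x|lebesgue_on (cube a). 1/2 * (norm (u (x, t)))\<^sup>2 + k (x, t))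
        + (LINT s|lebesgue_on {0<..<t}. LINT x|lebesgue_on (cube a). \<alpha>2 * k (x, s) * \<omega> (x, s))
        \<le> (LINT x|lebesgue_on (cube a). 1/2 * (norm (u0 x))\<^sup>2 + k0 x)
          + (LINT s|lebesgue_on {0<..<t}. LINT x|lebesgue_on (cube a). f (x, s) \<bullet> u (x, s)))"

definition total_energy_equality ::
    "real \<Rightarrow> real \<Rightarrow>
     (space_time \<Rightarrow> real^3) \<Rightarrow> (real^3 \<Rightarrow> real^3) \<Rightarrow> (real^3 \<Rightarrow> real) \<Rightarrow>
     (space_time \<Rightarrow> real^3) \<Rightarrow> (space_time \<Rightarrow> real) \<Rightarrow> (space_time \<Rightarrow> real) \<Rightarrow> real \<Rightarrow> bool"
  where
  "total_energy_equality a \<alpha>2 f u0 k0 u \<omega> k t \<longleftrightarrow>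
     (LINT x|lebesgue_on (cube a). 1/2 * (norm (u (x, t)))\<^sup>2 + k (x, t))
     + \<alpha>2 * (LINT s|lebesgue_on {0<..<t}. LINT x|lebesgue_on (cube a). k (x, s) * \<omega> (x, s))
     = (LINT x|lebesgue_on (cube a). 1/2 * (norm (u0 x))\<^sup>2 + k0 x)
       + (LINT s|lebesgue_on {0<..<t}. LINT x|lebesgue_on (cube a). f (x, s) \<bullet> u (x, s))"

definition kinetic_energy_equality ::
    "real \<Rightarrow> real \<Rightarrow> real \<Rightarrow> (space_time \<Rightarrow> real^3) \<Rightarrow> (real^3 \<Rightarrow> real^3) \<Rightarrow>
     (space_time \<Rightarrow> real^3) \<Rightarrow> (space_time \<Rightarrow> real) \<Rightarrow> (space_time \<Rightarrow> real) \<Rightarrow> real \<Rightarrow> bool"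
  where
  "kinetic_energy_equality a T \<nu>0 f u0 u \<omega> k t \<longleftrightarrow>
     (LINT x|lebesgue_on (cube a). 1/2 * (norm (u (x, t)))\<^sup>2)
     + \<nu>0 * (LINT s|lebesgue_on {0<..<t}. LINT x|lebesgue_on (cube a).
          k (x, s) / \<omega> (x, s) * (norm (strain a T u (x, s)))\<^sup>2)
     = 1/2 * (LINT x|lebesgue_on (cube a). (norm (u0 x))\<^sup>2)
       + (LINT s|lebesgue_on {0<..<t}. LINT x|lebesgue_on (cube a). f (x, s) \<bullet> u (x, s))"

(* Test functions vanish at t = T, hence the weak formulation determines a defect measure only
   on the part t < T of the closed cylinder: adding any finite measure concentrated on t = T
   yields a defect measure for the same triple. *)
definition lower_part :: "real \<Rightarrow> real \<Rightarrow> space_time set" where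
  "lower_part a T = {z \<in> closure (cyl a T). snd z < T}"

definition top_part :: "real \<Rightarrow> real \<Rightarrow> space_time set" where
  "top_part a T = {z \<in> closure (cyl a T). snd z = T}"

definition zero_measure :: "real \<Rightarrow> real \<Rightarrow> space_time measure" where
  "zero_measure a T = null_measure (restrict_space borel (closure (cyl a T)))"

end

theory Submission
  imports Defs
begin

text \<open>
  Let \<open>E t\<close> be the amount by which the kinetic energy inequality at time \<open>t\<close> fails to be an
  equality, so \<open>E \<ge> 0\<close> almost everywhere. The total energy equality expresses \<open>E t\<close> as the integral
  of \<open>k(\<cdot>, t)\<close> minus the value that the equation for \<open>k\<close> with \<open>\<mu> = 0\<close> would predict for it.
  Testing that equation with the single function \<open>(x, t) \<mapsto> T - t\<close> and exchanging the order of the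
  time integrals therefore gives \<open>\<integral> (T - t) d\<mu> = \<integral>\<^sub>0\<^sup>T E t dt\<close>. Both integrands are
  non-negative: the left side vanishes iff \<open>\<mu>\<close> does not charge \<open>t < T\<close>, the right side iff
  \<open>E = 0\<close> almost everywhere.
\<close>

section \<open>Slices and iterated integrals for completed Lebesgue measure\<close>

lemma AE_lborel_slice:
  fixes P :: "'a::euclidean_space \<times> 'b::euclidean_space \<Rightarrow> bool"
  assumes "AE z in lborel. P z"
  shows "AE y in lborel. AE x in lborel. P (x, y)"
proof -
  \<comment> \<open>The exceptional set of \<open>P\<close> need not be Borel, but exchanging the
    two almost-everywhere quantifiers requires a measurable predicate; the proof therefore works
    with a Borel null set \<open>N\<close> enclosing it.\<close>
  obtain N where N: "N \<in> null_sets lborel" "{z. \<not> P z} \<subseteq> N"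
    using assms by (auto simp: eventually_ae_filter)
  have [measurable]: "N \<in> sets (lborel \<Otimes>\<^sub>M lborel)"
    unfolding lborel_prod using N(1) by (rule null_setsD2)
  have "AE z in lborel \<Otimes>\<^sub>M lborel. z \<notin> N"
    unfolding lborel_prod by (rule AE_not_in[OF N(1)])
  then have "AE x in lborel. AE y in lborel. (x, y) \<notin> N"
    by (rule lborel_pair.AE_pair)
  then have "AE y in lborel. AE x in lborel. (x, y) \<notin> N"
    by (subst lborel_pair.AE_commute[symmetric]) measurable
  then show ?thesis
    using N(2) by (auto elim!: eventually_mono)
qed

text \<open>Lebesgue measure on a product is the completion of a product measure, not a product of
  completions, so the Fubini theorems apply to a Borel version \<open>h\<close> rather than to
  \<open>g\<close>. A slice of \<open>g\<close> inherits measurability by completeness, but only for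
  those \<open>y\<close> for which it agrees almost everywhere with the slice of
  \<open>h\<close>.\<close>

lemma lebesgue_borel_version:
  fixes g :: "'a::euclidean_space \<times> 'b::euclidean_space \<Rightarrow> real"
  assumes "g \<in> borel_measurable lebesgue"
  obtains h where "h \<in> borel_measurable borel" "AE z in lborel. g z = h z"
    "AE y in lborel. (\<lambda>x. g (x, y)) \<in> borel_measurable lebesgue \<and> (AE x in lebesgue. g (x, y) = h (x, y))"
proof -
  obtain h where h: "h \<in> borel_measurable lborel" "AE z in lborel. g z = h z"
    using completion_ex_borel_measurable_real[OF assms] by blast
  have [measurable]: "h \<in> borel_measurable (lborel \<Otimes>\<^sub>M lborel)"
    unfolding lborel_prod by (rule h(1))
  have "AE y in lborel. AE x in lborel. g (x, y) = h (x, y)"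
    using AE_lborel_slice[OF h(2)] .
  then have "AE y in lborel. (\<lambda>x. g (x, y)) \<in> borel_measurable lebesgue \<and> (AE x in lebesgue. g (x, y) = h (x, y))"
  proof (eventually_elim, intro conjI)
    fix y assume *: "AE x in lborel. g (x, y) = h (x, y)"
    show **: "AE x in lebesgue. g (x, y) = h (x, y)" by (rule AE_completion[OF *])
    have "(\<lambda>x. h (x, y)) \<in> borel_measurable lborel"
      by measurable
    then have "(\<lambda>x. h (x, y)) \<in> borel_measurable lebesgue"
      by (rule measurable_completion)
    then show "(\<lambda>x. g (x, y)) \<in> borel_measurable lebesgue"
      by (rule borel_measurable_AE) (use ** in \<open>simp add: eq_commute\<close>)
  qed
  with h that show ?thesis by auto
qed

text \<open>Fubini holds for the Borel version \<open>h\<close>; each integral is carried over to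
  \<open>g\<close> by almost-everywhere equality, first on the slices and then on the slice
  integrals. The second variable, which will be time, is the outer one.\<close>

lemma lebesgue_Fubini:
  fixes g :: "'a::euclidean_space \<times> 'b::euclidean_space \<Rightarrow> real"
  assumes g: "integrable lebesgue g"
  shows "AE y in lebesgue. integrable lebesgue (\<lambda>x. g (x, y))"
    and "integrable lebesgue (\<lambda>y. LINT x|lebesgue. g (x, y))"
    and "(LINT y|lebesgue. LINT x|lebesgue. g (x, y)) = (LINT z|lebesgue. g z)"
proof -
  have gm: "g \<in> borel_measurable lebesgue"
    using g by simp
  obtain h where h: "h \<in> borel_measurable borel" "AE z in lborel. g z = h z"
    and sl: "AE y in lborel. (\<lambda>x. g (x, y)) \<in> borel_measurable lebesgue \<and>
      (AE x in lebesgue. g (x, y) = h (x, y))"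
    using lebesgue_borel_version[OF gm] by blast
  have hm: "h \<in> borel_measurable lborel"
    using h(1) by simp
  have ae: "AE z in lebesgue. g z = h z"
    using h(2) by (rule AE_completion)
  have hl: "h \<in> borel_measurable lebesgue"
    using hm by (rule measurable_completion)
  have "integrable lebesgue h"
    using g integrable_cong_AE[OF gm hl ae] by blast
  then have "integrable lborel h"
    by (simp add: integrable_completion[OF hm])
  then have "integrable (lborel \<Otimes>\<^sub>M lborel) (case_prod (\<lambda>x y. h (x, y)))"
    by (simp add: lborel_prod)
  note hF = lborel_pair.AE_integrable_snd[OF this] lborel_pair.integrable_snd[OF this]
    lborel_pair.integral_snd[OF this]
  have hy: "(\<lambda>x. h (x, y)) \<in> borel_measurable lborel" for y
    using h(1) by simp
  have eq: "AE y in lborel. integrable lebesgue (\<lambda>x. g (x, y)) \<and>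
      (LINT x|lebesgue. g (x, y)) = (LINT x|lborel. h (x, y))"
    using sl hF(1)
  proof eventually_elim
    fix y
    assume *: "(\<lambda>x. g (x, y)) \<in> borel_measurable lebesgue \<and> (AE x in lebesgue. g (x, y) = h (x, y))"
      and i: "integrable lborel (\<lambda>x. h (x, y))"
    have hyl: "(\<lambda>x. h (x, y)) \<in> borel_measurable lebesgue"
      using hy by (rule measurable_completion)
    show "integrable lebesgue (\<lambda>x. g (x, y)) \<and>
      (LINT x|lebesgue. g (x, y)) = (LINT x|lborel. h (x, y))"
      using * i integrable_cong_AE[OF _ hyl, of "\<lambda>x. g (x, y)"]
        integral_cong_AE[OF _ hyl, of "\<lambda>x. g (x, y)"]
      by (simp add: integrable_completion[OF hy] integral_completion[OF hy])
  qed
  then have eq': "AE y in lebesgue. integrable lebesgue (\<lambda>x. g (x, y)) \<and>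
      (LINT x|lebesgue. g (x, y)) = (LINT x|lborel. h (x, y))"
    by (rule AE_completion)
  then show "AE y in lebesgue. integrable lebesgue (\<lambda>x. g (x, y))"
    by auto
  have Hm: "(\<lambda>y. LINT x|lborel. h (x, y)) \<in> borel_measurable lborel"
    using hF(2) by (rule borel_measurable_integrable)
  have Hi: "integrable lebesgue (\<lambda>y. LINT x|lborel. h (x, y))"
    using hF(2) by (simp only: integrable_completion[OF Hm])
  have ae2: "AE y in lebesgue. (LINT x|lborel. h (x, y)) = (LINT x|lebesgue. g (x, y))"
    using eq' by auto
  have Gm: "(\<lambda>y. LINT x|lebesgue. g (x, y)) \<in> borel_measurable lebesgue"
    using borel_measurable_AE[OF borel_measurable_integrable[OF Hi] ae2] .
  show "integrable lebesgue (\<lambda>y. LINT x|lebesgue. g (x, y))"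
    using Hi integrable_cong_AE[OF borel_measurable_integrable[OF Hi] Gm ae2] by blast
  have "(LINT y|lebesgue. LINT x|lebesgue. g (x, y)) = (LINT y|lborel. LINT x|lborel. h (x, y))"
    using integral_cong_AE[OF borel_measurable_integrable[OF Hi] Gm ae2] integral_completion[OF Hm]
    by simp
  also have "\<dots> = (LINT z|lborel. h z)"
    using hF(3) by (simp add: lborel_prod)
  also have "\<dots> = (LINT z|lebesgue. g z)"
    using integral_cong_AE[OF gm hl ae] integral_completion[OF hm] by simp
  finally show "(LINT y|lebesgue. LINT x|lebesgue. g (x, y)) = (LINT z|lebesgue. g z)" .
qed

text \<open>Extension by zero reduces this to the whole space, because the indicator of
  \<open>A \<times> B\<close> factors into the indicators of \<open>A\<close> and
  \<open>B\<close>.\<close>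

lemma lebesgue_on_Fubini:
  fixes g :: "'a::euclidean_space \<times> 'b::euclidean_space \<Rightarrow> real"
  assumes A: "A \<in> sets borel" and B: "B \<in> sets borel"
    and g: "integrable (lebesgue_on (A \<times> B)) g"
  shows "AE y in lebesgue_on B. integrable (lebesgue_on A) (\<lambda>x. g (x, y))"
    and "integrable (lebesgue_on B) (\<lambda>y. LINT x|lebesgue_on A. g (x, y))"
    and "(LINT y|lebesgue_on B. LINT x|lebesgue_on A. g (x, y)) = (LINT z|lebesgue_on (A \<times> B). g z)"
proof -
  have AB: "A \<times> B \<in> sets lebesgue"
    using borel_Times[OF A B] by simp
  have AL: "A \<in> sets lebesgue" and BL: "B \<in> sets lebesgue"
    using A B by simp_all
  have "integrable lebesgue (\<lambda>z. indicator (A \<times> B) z *\<^sub>R g z)"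
    using g AB by (simp add: integrable_restrict_space)
  note F = lebesgue_Fubini[OF this]
  have ind: "indicator (A \<times> B) (x, y) *\<^sub>R g (x, y) = indicator B y * (indicator A x *\<^sub>R g (x, y))" for x y
    by (auto simp: indicator_def)
  have inner: "(LINT x|lebesgue. indicator (A \<times> B) (x, y) *\<^sub>R g (x, y))
      = indicator B y *\<^sub>R (LINT x|lebesgue_on A. g (x, y))" for y
    unfolding ind using AL by (simp add: integral_restrict_space)
  have "AE y in lebesgue. y \<in> B \<longrightarrow> integrable lebesgue (\<lambda>x. indicator A x *\<^sub>R g (x, y))"
    using F(1) unfolding ind by eventually_elim (auto simp: indicator_def)
  then show "AE y in lebesgue_on B. integrable (lebesgue_on A) (\<lambda>x. g (x, y))"
    using AL BL by (simp add: integrable_restrict_space AE_restrict_space_iff)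
  show "integrable (lebesgue_on B) (\<lambda>y. LINT x|lebesgue_on A. g (x, y))"
    using F(2) BL unfolding inner by (simp add: integrable_restrict_space)
  show "(LINT y|lebesgue_on B. LINT x|lebesgue_on A. g (x, y)) = (LINT z|lebesgue_on (A \<times> B). g z)"
    using F(3) AB BL unfolding inner by (simp add: integral_restrict_space)
qed

text \<open>Fubini presupposes joint integrability; this lemma supplies it from information on
  slices. Tonelli for \<open>\<bar>h\<bar>\<close>, with \<open>h\<close> a Borel version of
  \<open>g\<close>, bounds the integral over the product by that of
  \<open>\<bar>b\<bar>\<close>.\<close>

lemma lebesgue_Tonelli_bounded:
  fixes g :: "'a::euclidean_space \<times> 'b::euclidean_space \<Rightarrow> real"
  assumes g: "g \<in> borel_measurable lebesgue"
    and b: "integrable lebesgue b"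
    and sl: "AE y in lebesgue. integrable lebesgue (\<lambda>x. g (x, y)) \<and> (LINT x|lebesgue. \<bar>g (x, y)\<bar>) \<le> b y"
  shows "integrable lebesgue g"
proof -
  obtain h where h: "h \<in> borel_measurable borel" "AE z in lborel. g z = h z"
    and hsl: "AE y in lborel. (\<lambda>x. g (x, y)) \<in> borel_measurable lebesgue \<and>
      (AE x in lebesgue. g (x, y) = h (x, y))"
    using lebesgue_borel_version[OF g] by blast
  have hm: "h \<in> borel_measurable lborel"
    using h(1) by simp
  have ae: "AE z in lebesgue. g z = h z"
    using h(2) by (rule AE_completion)
  have hl: "h \<in> borel_measurable lebesgue"
    using hm by (rule measurable_completion)
  have hp[measurable]: "h \<in> borel_measurable (lborel \<Otimes>\<^sub>M lborel)"
    unfolding lborel_prod by (rule hm)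
  have "AE y in lebesgue. (\<integral>\<^sup>+x. ennreal \<bar>h (x, y)\<bar> \<partial>lborel) \<le> ennreal \<bar>b y\<bar>"
    using sl AE_completion[OF hsl]
  proof eventually_elim
    fix y
    assume 1: "integrable lebesgue (\<lambda>x. g (x, y)) \<and> (LINT x|lebesgue. \<bar>g (x, y)\<bar>) \<le> b y"
      and 2: "(\<lambda>x. g (x, y)) \<in> borel_measurable lebesgue \<and> (AE x in lebesgue. g (x, y) = h (x, y))"
    have "(\<integral>\<^sup>+x. ennreal \<bar>h (x, y)\<bar> \<partial>lborel) = (\<integral>\<^sup>+x. ennreal \<bar>h (x, y)\<bar> \<partial>lebesgue)"
      by (simp add: nn_integral_completion)
    also have "\<dots> = (\<integral>\<^sup>+x. ennreal \<bar>g (x, y)\<bar> \<partial>lebesgue)"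
      using 2 by (intro nn_integral_cong_AE) auto
    also have "\<dots> = ennreal (LINT x|lebesgue. \<bar>g (x, y)\<bar>)"
      using 1 by (intro nn_integral_eq_integral) auto
    also have "\<dots> \<le> ennreal \<bar>b y\<bar>"
      using 1 by (intro ennreal_leI) auto
    finally show "(\<integral>\<^sup>+x. ennreal \<bar>h (x, y)\<bar> \<partial>lborel) \<le> ennreal \<bar>b y\<bar>" .
  qed
  then have "(\<integral>\<^sup>+y. (\<integral>\<^sup>+x. ennreal \<bar>h (x, y)\<bar> \<partial>lborel) \<partial>lebesgue) \<le> (\<integral>\<^sup>+y. ennreal \<bar>b y\<bar> \<partial>lebesgue)"
    by (rule nn_integral_mono_AE)
  also have "\<dots> < \<infinity>"
    using b by (simp add: integrable_iff_bounded)
  finally have "(\<integral>\<^sup>+y. (\<integral>\<^sup>+x. ennreal \<bar>h (x, y)\<bar> \<partial>lborel) \<partial>lborel) < \<infinity>"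
    by (simp add: nn_integral_completion)
  also have "(\<integral>\<^sup>+y. (\<integral>\<^sup>+x. ennreal \<bar>h (x, y)\<bar> \<partial>lborel) \<partial>lborel)
      = (\<integral>\<^sup>+z. ennreal \<bar>h z\<bar> \<partial>(lborel \<Otimes>\<^sub>M lborel))"
    by (rule lborel_pair.nn_integral_snd) measurable
  finally have "integrable lborel h"
    using hm by (simp add: integrable_iff_bounded lborel_prod)
  then have "integrable lebesgue h"
    by (simp add: integrable_completion[OF hm])
  then show ?thesis
    using integrable_cong_AE[OF g hl ae] by blast
qed

text \<open>This turns a bound that is uniform in time for the spatial L^1 norm into integrability
  over the cylinder: as \<open>B\<close> has finite measure, \<open>C * indicator B\<close> is an
  integrable majorant of the slice norms.\<close>

lemma lebesgue_on_Tonelli_bounded: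
  fixes g :: "'a::euclidean_space \<times> 'b::euclidean_space \<Rightarrow> real"
  assumes A: "A \<in> sets borel" and B: "B \<in> sets borel" "emeasure lborel B < \<infinity>"
    and g: "g \<in> borel_measurable (lebesgue_on (A \<times> B))"
    and sl: "AE y in lebesgue_on B. integrable (lebesgue_on A) (\<lambda>x. g (x, y)) \<and>
      (LINT x|lebesgue_on A. \<bar>g (x, y)\<bar>) \<le> C"
  shows "integrable (lebesgue_on (A \<times> B)) g"
proof -
  have AB: "A \<times> B \<in> sets lebesgue"
    using borel_Times[OF A B(1)] by simp
  have AL: "A \<in> sets lebesgue" and BL: "B \<in> sets lebesgue"
    using A B by simp_all
  have ind: "indicator (A \<times> B) (x, y) *\<^sub>R g (x, y) = indicator B y * (indicator A x *\<^sub>R g (x, y))" for x y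
    by (auto simp: indicator_def)
  have ind': "\<bar>indicator (A \<times> B) (x, y) *\<^sub>R g (x, y)\<bar> = indicator B y * (indicator A x *\<^sub>R \<bar>g (x, y)\<bar>)" for x y
    by (auto simp: indicator_def)
  have inner: "(LINT x|lebesgue. \<bar>indicator (A \<times> B) (x, y) *\<^sub>R g (x, y)\<bar>)
      = indicator B y *\<^sub>R (LINT x|lebesgue_on A. \<bar>g (x, y)\<bar>)" for y
    unfolding ind' using AL by (simp add: integral_restrict_space)
  have "integrable lebesgue (\<lambda>z. indicator (A \<times> B) z *\<^sub>R g z)"
  proof (rule lebesgue_Tonelli_bounded[where b = "\<lambda>y. C * indicator B y"])
    show "(\<lambda>z. indicator (A \<times> B) z *\<^sub>R g z) \<in> borel_measurable lebesgue"
      using g AB by (simp add: borel_measurable_restrict_space_iff)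
    show "integrable lebesgue (\<lambda>y. C * indicator B y)"
      using B by (intro integrable_mult_right) (simp add: integrable_completion)
    have "AE y in lebesgue. y \<in> B \<longrightarrow> integrable lebesgue (\<lambda>x. indicator A x *\<^sub>R g (x, y)) \<and>
      (LINT x|lebesgue_on A. \<bar>g (x, y)\<bar>) \<le> C"
      using sl AL BL by (simp add: integrable_restrict_space AE_restrict_space_iff imp_conjR)
    then show "AE y in lebesgue. integrable lebesgue (\<lambda>x. indicator (A \<times> B) (x, y) *\<^sub>R g (x, y)) \<and>
      (LINT x|lebesgue. \<bar>indicator (A \<times> B) (x, y) *\<^sub>R g (x, y)\<bar>) \<le> C * indicator B y"
      unfolding inner unfolding ind by eventually_elim (auto simp: indicator_def)
  qed
  then show ?thesis
    using AB by (simp add: integrable_restrict_space)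
qed

text \<open>Fubini on the triangle \<open>0 < s < t < T\<close>: for fixed \<open>s\<close> the
  admissible \<open>t\<close> form an interval of length \<open>T - s\<close>. This links the time
  integral of an accumulated source with the source weighted by the test function
  \<open>T - t\<close>.\<close>

lemma integral_primitive:
  fixes p :: "real \<Rightarrow> real"
  assumes p: "integrable (lebesgue_on {0<..<T}) p"
  shows "integrable (lebesgue_on {0<..<T}) (\<lambda>t. LINT s|lebesgue_on {0<..<t}. p s)"
    and "(LINT t|lebesgue_on {0<..<T}. LINT s|lebesgue_on {0<..<t}. p s)
      = (LINT s|lebesgue_on {0<..<T}. (T - s) * p s)"
proof -
  let ?M = "lebesgue_on {0<..<T}"
  have fM: "finite_measure ?M"
    by (rule finite_measure_lebesgue_on) simp
  interpret finite_measure ?M by (rule fM)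
  interpret pair_sigma_finite ?M ?M ..
  have pm[measurable]: "p \<in> borel_measurable ?M" using p by simp
  have idm[measurable]: "(\<lambda>x. x) \<in> borel_measurable ?M"
    by (intro measurable_restrict_space1 measurable_completion) simp
  have fsm[measurable]: "(\<lambda>z. fst z) \<in> borel_measurable (?M \<Otimes>\<^sub>M ?M)"
     "(\<lambda>z. snd z) \<in> borel_measurable (?M \<Otimes>\<^sub>M ?M)"
    using measurable_compose[OF measurable_fst idm] measurable_compose[OF measurable_snd idm] by auto
  \<comment> \<open>\<open>?f\<close> is \<open>p s\<close> on the triangle, extended by zero to the
    square, so that both orders of integration run over the same space \<open>?M\<close>.\<close>
  let ?f = "\<lambda>s t. if s < t then p s else 0"
  have m[measurable]: "(\<lambda>z. ?f (fst z) (snd z)) \<in> borel_measurable (?M \<Otimes>\<^sub>M ?M)"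
    by measurable
  have in1: "integrable ?M (\<lambda>t. ?f s t)" for s
  proof (rule Bochner_Integration.integrable_bound)
    show "integrable ?M (\<lambda>t. p s)" by simp
  qed auto
  have ev: "(LINT t|?M. c * (if s < t then 1 else 0)) = c * (T - s)" if "s \<in> {0<..<T}" for s c :: real
  proof -
    have "(LINT t|?M. c * (if s < t then 1 else 0)) = c * (LINT t|?M. indicator {s<..<T} t)"
      unfolding integral_mult_right_zero
      by (intro arg_cong[where f = "\<lambda>x. c * x"] Bochner_Integration.integral_cong) (auto simp: indicator_def)
    also have "(LINT t|?M. indicator {s<..<T} t) = (LINT t|lebesgue. indicator {0<..<T} t *\<^sub>R indicator {s<..<T} t :: real)"
      by (rule integral_restrict_space) simp
    also have "(\<lambda>t. indicator {0<..<T} t *\<^sub>R indicator {s<..<T} t :: real) = indicator {s<..<T}"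
      using that by (auto simp: indicator_def)
    also have "(LINT t|lebesgue. indicator {s<..<T} t) = T - s"
      using that by simp
    finally show ?thesis .
  qed
  have eq1: "(LINT t|?M. ?f s t) = (T - s) * p s" if "s \<in> {0<..<T}" for s
  proof -
    have "(LINT t|?M. ?f s t) = (LINT t|?M. p s * (if s < t then 1 else 0))"
      by (intro Bochner_Integration.integral_cong) auto
    then show ?thesis using ev[OF that, of "p s"] by simp
  qed
  have eq2: "(LINT t|?M. norm (?f s t)) = (T - s) * \<bar>p s\<bar>" if "s \<in> {0<..<T}" for s
  proof -
    have "(LINT t|?M. norm (?f s t)) = (LINT t|?M. \<bar>p s\<bar> * (if s < t then 1 else 0))"
      by (intro Bochner_Integration.integral_cong) auto
    then show ?thesis using ev[OF that, of "\<bar>p s\<bar>"] by simp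
  qed
  have "integrable (?M \<Otimes>\<^sub>M ?M) (\<lambda>z. ?f (fst z) (snd z))"
  proof (rule Fubini_integrable)
    have "integrable ?M (\<lambda>s. (T - s) * \<bar>p s\<bar>)"
    proof (rule Bochner_Integration.integrable_bound)
      show "integrable ?M (\<lambda>s. T * p s)" using p by simp
      show "AE s in ?M. norm ((T - s) * \<bar>p s\<bar>) \<le> norm (T * p s)"
        by (rule AE_I2) (auto simp: abs_mult intro!: mult_right_mono)
    qed measurable
    then show "integrable ?M (\<lambda>s. LINT t|?M. norm (?f (fst (s, t)) (snd (s, t))))"
      by (rule Bochner_Integration.integrable_cong[THEN iffD1, rotated 2]) (auto simp: eq2 simp del: real_norm_def cong: if_cong)
  qed (auto simp: in1 cong: if_cong)
  then have I: "integrable (?M \<Otimes>\<^sub>M ?M) (case_prod ?f)"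
    by (simp add: case_prod_beta')
  have inner: "(LINT s|?M. ?f s t) = (LINT s|lebesgue_on {0<..<t}. p s)" if "t \<in> {0<..<T}" for t
  proof -
    have "(LINT s|?M. ?f s t) = (LINT s|lebesgue. indicator {0<..<T} s *\<^sub>R ?f s t)"
      by (rule integral_restrict_space) simp
    also have "(\<lambda>s. indicator {0<..<T} s *\<^sub>R ?f s t) = (\<lambda>s. indicator {0<..<t} s *\<^sub>R p s)"
      using that by (auto simp: indicator_def)
    also have "(LINT s|lebesgue. indicator {0<..<t} s *\<^sub>R p s) = (LINT s|lebesgue_on {0<..<t}. p s)"
      by (rule integral_restrict_space[symmetric]) simp
    finally show ?thesis .
  qed
  show "integrable ?M (\<lambda>t. LINT s|lebesgue_on {0<..<t}. p s)"
    using integrable_snd[OF I]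
    by (rule Bochner_Integration.integrable_cong[THEN iffD1, rotated 2]) (auto simp: inner)
  have "(LINT t|?M. LINT s|lebesgue_on {0<..<t}. p s) = (LINT t|?M. LINT s|?M. ?f s t)"
    by (rule Bochner_Integration.integral_cong) (simp_all add: inner)
  also have "\<dots> = (LINT s|?M. LINT t|?M. ?f s t)"
    by (rule Fubini_integral[OF I])
  also have "\<dots> = (LINT s|?M. (T - s) * p s)"
    by (intro Bochner_Integration.integral_cong) (auto simp: eq1)
  finally show "(LINT t|?M. LINT s|lebesgue_on {0<..<t}. p s) = (LINT s|?M. (T - s) * p s)" .
qed

section \<open>The closed cylinder and the test function T - t\<close>

lemma cube_eq_box: "cube a = box 0 (\<chi> i. a)"
  by (auto simp: cube_def mem_box_cart)

lemma cyl_eq_box: "cyl a T = box (0, 0) (\<chi> i. a, T)"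
  unfolding cyl_def cube_eq_box
  by (auto simp: mem_box Basis_prod_def ball_Un)

lemma closure_cyl:
  assumes "a > 0" "T > 0"
  shows "closure (cyl a T) = cbox (0, 0) (\<chi> i. a, T)"
proof -
  \<comment> \<open>The centre witnesses that the open box is nonempty, without which its closure
    would not be the closed box.\<close>
  have "((\<chi> i. a / 2), T / 2) \<in> cyl a T"
    using assms by (auto simp: cyl_def cube_def)
  then show ?thesis
    unfolding cyl_eq_box by (intro closure_box) blast
qed

lemma snd_closure_cyl:
  assumes "T > 0" "z \<in> closure (cyl a T)"
  shows "0 \<le> snd z \<and> snd z \<le> T"
  using assms by (cases z) (auto simp: cyl_def closure_Times)

text \<open>\<open>frechet_derivative\<close> picks some derivative, so its value is known only
  where derivatives are unique. In a closed box with nonempty interior this includes the boundary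
  points, where the derivative is one-sided.\<close>

lemma frechet_derivative_time:
  assumes "a > 0" "T > 0" "z \<in> closure (cyl a T)"
  shows "frechet_derivative (\<lambda>z. T - snd z) (at z within closure (cyl a T)) = (\<lambda>h. - snd h)"
proof -
  have d: "((\<lambda>z::space_time. T - snd z) has_derivative (\<lambda>h. - snd h)) (at z within closure (cyl a T))"
    by (auto intro!: derivative_eq_intros)
  then have "((\<lambda>z. T - snd z) has_derivative frechet_derivative (\<lambda>z. T - snd z) (at z within closure (cyl a T)))
      (at z within closure (cyl a T))"
    using frechet_derivative_works differentiableI by blast
  note this[unfolded closure_cyl[OF assms(1,2)]] d[unfolded closure_cyl[OF assms(1,2)]]
  with assms show ?thesis
    unfolding closure_cyl[OF assms(1,2)]
    by (intro frechet_derivative_unique_within_closed_interval[where a = "(0, 0)" and b = "(\<chi> i. a, T)"])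
      (auto simp: Basis_prod_def Basis_vec_def inner_axis)
qed

lemma dt_time:
  assumes "a > 0" "T > 0" "z \<in> closure (cyl a T)"
  shows "dt a T (\<lambda>z. T - snd z) z = - 1"
  unfolding dt_def frechet_derivative_time[OF assms] by simp

lemma grad_time:
  assumes "a > 0" "T > 0" "z \<in> closure (cyl a T)"
  shows "grad a T (\<lambda>z. T - snd z) z = 0"
  unfolding grad_def frechet_derivative_time[OF assms] by (simp add: vec_eq_iff)

text \<open>A function of time alone takes equal values on opposite faces and has zero spatial
  gradient; this one also vanishes at \<open>t = T\<close>.\<close>

lemma C1_per_T_time:
  assumes "a > 0" "T > 0"
  shows "C1_per_T a T (\<lambda>z. T - snd z)"
proof -
  let ?S = "closure (cyl a T)"
  have "(\<lambda>z. T - snd z) differentiable_on ?S"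
    unfolding differentiable_on_def
    by (auto intro!: differentiableI derivative_eq_intros)
  moreover have "continuous_on ?S (\<lambda>x. frechet_derivative (\<lambda>z. T - snd z) (at x within ?S) e)" for e
    using continuous_on_const[of ?S "- snd e"]
    by (rule continuous_on_cong[THEN iffD1, rotated 2]) (simp_all add: frechet_derivative_time[OF assms])
  ultimately have "Ck_on 1 ?S (\<lambda>z. T - snd z)"
    by simp
  \<comment> \<open>The lateral faces lie in the closure of the cylinder, so
    \<open>grad_time\<close> also gives the gradients compared in the periodicity condition.\<close>
  moreover have "(x, t) \<in> ?S" if "x \<in> face a i c" "t \<in> {0<..<T}" for x t i c
    using that closure_subset[of "{0<..<T}"]
    unfolding cyl_def closure_Times face_def frontier_def by auto
  ultimately show ?thesis
    unfolding C1_per_T_def by (auto simp: grad_time[OF assms])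
qed

section \<open>Null endpoints, restriction, and measurability of the strain\<close>

lemma AE_lebesgue_on_Icc_iff_Ioo:
  fixes a b :: real
  shows "(AE t in lebesgue_on {a..b}. P t) \<longleftrightarrow> (AE t in lebesgue_on {a<..<b}. P t)"
proof -
  have ne: "AE t in lebesgue. t \<noteq> a" "AE t in lebesgue. t \<noteq> b"
    by (intro AE_completion AE_lborel_singleton)+
  have "(AE t in lebesgue. t \<in> {a..b} \<longrightarrow> P t) \<longleftrightarrow> (AE t in lebesgue. t \<in> {a<..<b} \<longrightarrow> P t)"
  proof
    assume "AE t in lebesgue. t \<in> {a..b} \<longrightarrow> P t"
    then show "AE t in lebesgue. t \<in> {a<..<b} \<longrightarrow> P t"
      by eventually_elim auto
  next
    assume "AE t in lebesgue. t \<in> {a<..<b} \<longrightarrow> P t"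
    with ne show "AE t in lebesgue. t \<in> {a..b} \<longrightarrow> P t"
      by eventually_elim auto
  qed
  then show ?thesis
    by (simp add: AE_restrict_space_iff)
qed

lemma integrable_lebesgue_on_subset:
  fixes f :: "'a::euclidean_space \<Rightarrow> real"
  assumes "integrable (lebesgue_on B) f" "A \<subseteq> B" "A \<in> sets lebesgue" "B \<in> sets lebesgue"
  shows "integrable (lebesgue_on A) f"
proof -
  have "integrable lebesgue (\<lambda>x. indicator B x *\<^sub>R f x)"
    using assms by (simp add: integrable_restrict_space)
  then have i: "integrable lebesgue (\<lambda>x. indicator A x *\<^sub>R (indicator B x *\<^sub>R f x))"
    by (rule integrable_mult_indicator[OF assms(3)])
  have eq: "(\<lambda>x. indicator A x *\<^sub>R (indicator B x *\<^sub>R f x)) = (\<lambda>x. indicator A x *\<^sub>R f x)"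
    using assms(2) by (auto simp: indicator_def fun_eq_iff)
  show ?thesis
    using i[unfolded eq] assms(3) by (simp add: integrable_restrict_space)
qed

text \<open>\<open>sgrad\<close> is chosen by \<open>SOME\<close>, so its measurability rests on the
  existence of a spatial gradient for each component of \<open>u\<close>, which the Bochner space
  provides. Symmetrisation is linear, hence continuous, and preserves measurability.\<close>

lemma borel_measurable_norm_strain:
  assumes "Lq_W1p_per_div a T q p u"
  shows "(\<lambda>z. norm (strain a T u z)) \<in> borel_measurable (lebesgue_on (cyl a T))"
proof -
  let ?M = "lebesgue_on (cyl a T)"
  have s: "sgrad a T (\<lambda>z. u z $ i) \<in> borel_measurable ?M" for i
  proof -
    have "\<exists>G. spatial_gradient a T (\<lambda>z. u z $ i) G"
      using assms by (simp add: Lq_W1p_per_div_def Lq_W1p_per_def)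
    then have "spatial_gradient a T (\<lambda>z. u z $ i) (sgrad a T (\<lambda>z. u z $ i))"
      unfolding sgrad_def by (rule someI_ex)
    then show ?thesis
      by (simp add: spatial_gradient_def)
  qed
  have "sjac a T u \<in> borel_measurable ?M"
  proof (rule borel_measurable_euclidean_space[THEN iffD2], rule ballI)
    fix b :: "real^3^3"
    assume "b \<in> Basis"
    then obtain i c where b: "b = axis i c"
      by (auto simp: Basis_vec_def)
    have "(\<lambda>z. sgrad a T (\<lambda>z. u z $ i) z \<bullet> c) \<in> borel_measurable ?M"
      using s by (intro borel_measurable_inner) auto
    then show "(\<lambda>z. sjac a T u z \<bullet> b) \<in> borel_measurable ?M"
      by (simp add: b inner_axis sjac_def)
  qed
  moreover have "linear sym_part"
    by (rule linearI) (simp_all add: sym_part_def transpose_def vec_eq_iff algebra_simps)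
  then have "sym_part \<in> borel_measurable borel"
    by (intro borel_measurable_continuous_onI linear_continuous_on) (simp add: linear_conv_bounded_linear)
  ultimately have "(\<lambda>z. sym_part (sjac a T u z)) \<in> borel_measurable ?M"
    by (rule measurable_compose)
  then show ?thesis
    unfolding strain_def by measurable
qed

section \<open>Detecting the defect measure with T - t\<close>

text \<open>On the closed cylinder \<open>T - t\<close> is non-negative and is positive exactly for
  \<open>t < T\<close>, so its integral vanishes precisely when the set \<open>t < T\<close> is
  null.\<close>

lemma integral_time_measure_eq_0_iff:
  assumes "T > 0" "nonneg_radon_measure a T \<mu>"
  shows "(LINT z|\<mu>. T - snd z) = 0 \<longleftrightarrow> emeasure \<mu> (lower_part a T) = 0"
proof -
  let ?S = "closure (cyl a T)"
  have sets: "sets \<mu> = sets (restrict_space borel ?S)" and "finite_measure \<mu>"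
    using assms(2) by (auto simp: nonneg_radon_measure_def)
  interpret finite_measure \<mu> by fact
  have sp: "space \<mu> = ?S"
    using sets_eq_imp_space_eq[OF sets] by (simp add: space_restrict_space)
  have "(\<lambda>z::space_time. snd z) \<in> borel_measurable borel"
    by (intro borel_measurable_continuous_onI continuous_intros)
  then have [measurable]: "(\<lambda>z. snd z) \<in> borel_measurable \<mu>"
    unfolding measurable_cong_sets[OF sets refl] by (rule measurable_restrict_space1)
  have bd: "0 \<le> snd z" "snd z \<le> T" if "z \<in> space \<mu>" for z
    using snd_closure_cyl[OF assms(1)] that sp by auto
  have i: "integrable \<mu> (\<lambda>z. T - snd z)"
    by (rule integrable_const_bound[where B = T]) (use bd in \<open>auto intro!: AE_I2\<close>)
  have "(LINT z|\<mu>. T - snd z) = 0 \<longleftrightarrow> (AE z in \<mu>. T - snd z = 0)"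
    using i by (rule integral_nonneg_eq_0_iff_AE) (use bd in \<open>auto intro!: AE_I2\<close>)
  also have "\<dots> \<longleftrightarrow> emeasure \<mu> {z \<in> space \<mu>. \<not> T - snd z = 0} = 0"
    by (rule AE_iff_measurable) auto
  also have "{z \<in> space \<mu>. \<not> T - snd z = 0} = lower_part a T"
    using bd by (force simp: lower_part_def sp)
  finally show ?thesis .
qed

text \<open>The lower and top parts cover the closed cylinder; if both are null, the total mass is
  zero. Equality of measures also compares the sigma-algebras, which agree by
  \<open>nonneg_radon_measure\<close>.\<close>

lemma eq_zero_measure_iff:
  assumes "T > 0" "nonneg_radon_measure a T \<mu>" "emeasure \<mu> (top_part a T) = 0"
  shows "\<mu> = zero_measure a T \<longleftrightarrow> emeasure \<mu> (lower_part a T) = 0"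
proof
  assume "\<mu> = zero_measure a T"
  then show "emeasure \<mu> (lower_part a T) = 0"
    by (simp add: zero_measure_def)
next
  assume low: "emeasure \<mu> (lower_part a T) = 0"
  let ?S = "closure (cyl a T)"
  have sets: "sets \<mu> = sets (restrict_space borel ?S)"
    using assms(2) by (auto simp: nonneg_radon_measure_def)
  have sp: "space \<mu> = ?S"
    using sets_eq_imp_space_eq[OF sets] by (simp add: space_restrict_space)
  have "(\<lambda>z::space_time. snd z) \<in> borel_measurable borel"
    by (intro borel_measurable_continuous_onI continuous_intros)
  then have [measurable]: "(\<lambda>z. snd z) \<in> borel_measurable \<mu>"
    unfolding measurable_cong_sets[OF sets refl] by (rule measurable_restrict_space1)
  have eqs: "lower_part a T = {z \<in> space \<mu>. snd z < T}" "top_part a T = {z \<in> space \<mu>. snd z = T}"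
    by (auto simp: lower_part_def top_part_def sp)
  have m: "lower_part a T \<in> sets \<mu>" "top_part a T \<in> sets \<mu>"
    unfolding eqs by measurable
  have cover: "space \<mu> = lower_part a T \<union> top_part a T"
    using snd_closure_cyl[OF assms(1)] by (force simp: lower_part_def top_part_def sp)
  have "lower_part a T \<union> top_part a T \<in> null_sets \<mu>"
    using low assms(3) m by (intro null_sets.Un) auto
  then have null: "emeasure \<mu> (space \<mu>) = 0"
    using cover by auto
  show "\<mu> = zero_measure a T"
  proof (rule measure_eqI)
    show "sets \<mu> = sets (zero_measure a T)"
      by (simp add: sets zero_measure_def)
    fix A
    have "emeasure \<mu> A \<le> emeasure \<mu> (space \<mu>)"
      by (rule emeasure_space)
    then show "emeasure \<mu> A = emeasure (zero_measure a T) A"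
      using null by (simp add: zero_measure_def)
  qed
qed

section \<open>Equivalence of zero defect and kinetic energy equality\<close>

theorem proposition3p7:
  fixes a T \<nu>0 \<alpha>2 :: real
    and f u :: "space_time \<Rightarrow> real^3"
    and u0 :: "real^3 \<Rightarrow> real^3"
    and \<omega>0 k0 :: "real^3 \<Rightarrow> real"
    and \<omega> k :: "space_time \<Rightarrow> real"
    and \<mu> :: "space_time measure"
  assumes "a > 0" and "T > 0" and "\<nu>0 > 0" and "\<alpha>2 > 0"
    and "weak_solution_defect a T \<nu>0 \<alpha>2 f u0 \<omega>0 k0 u \<omega> k \<mu>"
    and "\<forall>t\<in>{0..T}. total_energy_equality a \<alpha>2 f u0 k0 u \<omega> k t"
  shows "(emeasure \<mu> (top_part a T) = 0 \<longrightarrow>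
            (\<mu> = zero_measure a T \<longleftrightarrow>
             (AE t in lebesgue_on {0..T}. kinetic_energy_equality a T \<nu>0 f u0 u \<omega> k t)))
       \<and> (emeasure \<mu> (lower_part a T) = 0 \<longleftrightarrow>
             (AE t in lebesgue_on {0..T}. kinetic_energy_equality a T \<nu>0 f u0 u \<omega> k t))"
proof -
  note W = assms(5)[unfolded weak_solution_defect_def]
  let ?C = "lebesgue_on (cube a)" and ?I = "lebesgue_on {0<..<T}" and ?Q = "lebesgue_on (cyl a T)"
  define n where "n z = norm (strain a T u z)" for z
  have data: "admissible_data a T f u0 \<omega>0 k0" and rad: "nonneg_radon_measure a T \<mu>"
    and \<omega>m[measurable]: "\<omega> \<in> borel_measurable ?Q" and km[measurable]: "k \<in> borel_measurable ?Q"
    and pos: "\<exists>c>0. AE z in ?Q. \<omega> z > 0 \<and> k z / \<omega> z \<ge> c"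
    and u2: "Linf_Lp a T 2 u" and ureg: "Lq_W1p_per_div a T 2 2 u" and k1: "Linf_Lp a T 1 k"
    using W by blast+
  have diss: "integrable ?Q (\<lambda>z. k z / \<omega> z *
        ((1 + norm (strain a T u z)) * norm (strain a T u z)
          + norm (sgrad a T \<omega> z) + norm (sgrad a T k z)))"
    using W by blast
  have weakk: "- (LINT z|?Q. k z * dt a T \<zeta> z) - (LINT z|?Q. k z * (u z \<bullet> grad a T \<zeta> z))
        + (LINT z|?Q. k z / \<omega> z * (sgrad a T k z \<bullet> grad a T \<zeta> z))
        = (LINT x|?C. k0 x * \<zeta> (x, 0))
          + (LINT z|?Q. (\<nu>0 * (k z / \<omega> z) * (norm (strain a T u z))\<^sup>2 - \<alpha>2 * k z * \<omega> z) * \<zeta> z)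
          + (LINT z|\<mu>. \<zeta> z)" if "C1_per_T a T \<zeta>" for \<zeta>
    using W that by blast
  have u0i: "integrable ?C (\<lambda>x. (norm (u0 x))\<^sup>2)"
    and k\<omega>i: "integrable ?Q (\<lambda>z. k z * \<omega> z)"
    using W by blast+
  have gen: "AE t in ?I. (LINT x|?C. 1/2 * (norm (u (x, t)))\<^sup>2)
        + (LINT s|lebesgue_on {0<..<t}. LINT x|?C. \<nu>0 * (k (x, s) / \<omega> (x, s)) * (n (x, s))\<^sup>2)
        \<le> (LINT x|?C. 1/2 * (norm (u0 x))\<^sup>2)
          + (LINT s|lebesgue_on {0<..<t}. LINT x|?C. f (x, s) \<bullet> u (x, s))"
    unfolding n_def AE_lebesgue_on_Icc_iff_Ioo[symmetric] using W by blast
  have nm[measurable]: "n \<in> borel_measurable ?Q"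
    unfolding n_def using ureg by (rule borel_measurable_norm_strain)
  have n0: "n z \<ge> 0" for z
    by (simp add: n_def)

  have Cb: "cube a \<in> sets borel" and Ib: "{0<..<T} \<in> sets borel"
    by (simp_all add: cube_eq_box)
  note F = lebesgue_on_Fubini[OF Cb Ib, folded cyl_def]

  have Di: "integrable ?Q (\<lambda>z. \<nu>0 * (k z / \<omega> z) * (n z)\<^sup>2)"
  proof -
    obtain c where c: "c > 0" "AE z in ?Q. \<omega> z > 0 \<and> k z / \<omega> z \<ge> c"
      using pos by blast
    have "integrable ?Q (\<lambda>z. k z / \<omega> z * (n z)\<^sup>2)"
      using diss
    proof (rule Bochner_Integration.integrable_bound)
      show "AE z in ?Q. norm (k z / \<omega> z * (n z)\<^sup>2) \<le> norm (k z / \<omega> z *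
        ((1 + norm (strain a T u z)) * norm (strain a T u z)
          + norm (sgrad a T \<omega> z) + norm (sgrad a T k z)))"
        using c(2)
      proof eventually_elim
        fix z
        assume "\<omega> z > 0 \<and> k z / \<omega> z \<ge> c"
        \<comment> \<open>The integrability condition \<open>diss\<close> dominates the dissipation:
          \<open>(1 + n z) * n z\<close> contains \<open>(n z)\<^sup>2\<close>, and the other
          summands are non-negative.\<close>
        have "(n z)\<^sup>2 \<le> (1 + n z) * n z + norm (sgrad a T \<omega> z) + norm (sgrad a T k z)"
          using n0[of z] by (simp add: algebra_simps power2_eq_square)
        moreover have "(n z)\<^sup>2 \<ge> 0"
          by simp
        ultimately show "norm (k z / \<omega> z * (n z)\<^sup>2) \<le> norm (k z / \<omega> z *
          ((1 + norm (strain a T u z)) * norm (strain a T u z)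
          + norm (sgrad a T \<omega> z) + norm (sgrad a T k z)))"
          unfolding n_def[symmetric] abs_mult real_norm_def
          by (intro mult_left_mono) linarith+
      qed
    qed measurable
    then have "integrable ?Q (\<lambda>z. \<nu>0 * (k z / \<omega> z * (n z)\<^sup>2))"
      by (rule integrable_mult_right)
    then show ?thesis
      by (simp add: mult.assoc)
  qed
  have ki: "integrable ?Q k"
  proof -
    \<comment> \<open>For exponent 1, \<open>Lp_norm\<close> is the integral of the absolute value,
      so the essential bound in time is just the slice bound needed for Tonelli on the bounded
      interval.\<close>
    obtain C where "AE t in ?I. Lp_on (cube a) 1 (\<lambda>x. k (x, t)) \<and> Lp_norm (cube a) 1 (\<lambda>x. k (x, t)) \<le> C"
      using k1 by (auto simp: Linf_Lp_def)
    then have "AE t in ?I. integrable ?C (\<lambda>x. k (x, t)) \<and> (LINT x|?C. \<bar>k (x, t)\<bar>) \<le> C"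
    proof eventually_elim
      fix t
      assume *: "Lp_on (cube a) 1 (\<lambda>x. k (x, t)) \<and> Lp_norm (cube a) 1 (\<lambda>x. k (x, t)) \<le> C"
      then have "integrable ?C (\<lambda>x. \<bar>k (x, t)\<bar>)" "(\<lambda>x. k (x, t)) \<in> borel_measurable ?C"
        by (auto simp: Lp_on_def)
      then have "integrable ?C (\<lambda>x. k (x, t))"
        by (rule integrable_abs_cancel)
      then show "integrable ?C (\<lambda>x. k (x, t)) \<and> (LINT x|?C. \<bar>k (x, t)\<bar>) \<le> C"
        using * by (simp add: Lp_norm_def)
    qed
    then show ?thesis
      unfolding cyl_def
      by (intro lebesgue_on_Tonelli_bounded[OF Cb Ib])
        (use km assms(2) in \<open>auto simp: cyl_def\<close>)
  qed
  have k0i: "integrable ?C k0"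
    using data integrable_abs_cancel[of ?C k0] by (auto simp: admissible_data_def Lp_on_def)
  have usl: "AE t in ?I. integrable ?C (\<lambda>x. 1/2 * (norm (u (x, t)))\<^sup>2)"
  proof -
    have "AE t in ?I. integrable ?C (\<lambda>x. (norm (u (x, t)))\<^sup>2)"
      using u2 by (auto simp: Linf_Lp_def Lp_on_def elim!: eventually_mono)
    then show ?thesis
      by eventually_elim (rule integrable_mult_right)
  qed

  \<comment> \<open>\<open>g\<close> is the source in the equation for \<open>k\<close> apart from
    \<mu>: dissipated kinetic energy minus the decay of \<open>k\<close>. Below, \<open>G t\<close>
    is the source accumulated up to time \<open>t\<close>, and \<open>E t\<close> is the part of the
    change of the total \<open>k\<close> that \<open>G t\<close> does not account for.\<close>
  define g where "g z = \<nu>0 * (k z / \<omega> z) * (n z)\<^sup>2 - \<alpha>2 * k z * \<omega> z" for z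
  have gi: "integrable ?Q g"
    using Di k\<omega>i unfolding g_def by (auto simp: mult.assoc)
  define K where "K t = (LINT x|?C. k (x, t))" for t
  define K0 where "K0 = (LINT x|?C. k0 x)"
  define G where "G t = (LINT s|lebesgue_on {0<..<t}. LINT x|?C. g (x, s))" for t
  define E where "E t = K t - K0 - G t" for t
  have Ki: "integrable ?I K"
    unfolding K_def by (rule F(2)[OF ki])
  have Gi: "integrable ?I G"
    unfolding G_def by (rule integral_primitive(1)[OF F(2)[OF gi]])
  have fin: "finite_measure ?I"
    by (rule finite_measure_lebesgue_on) simp
  have mI: "measure ?I (space ?I) = T"
    using assms(2) by (simp add: measure_restrict_space)
  have ci: "integrable ?I (\<lambda>t. K0)"
    using fin by (rule finite_measure.integrable_const)
  have Ei: "integrable ?I E"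
    unfolding E_def using Ki ci Gi by simp

  have Gsplit: "G t = (LINT s|lebesgue_on {0<..<t}. LINT x|?C. \<nu>0 * (k (x, s) / \<omega> (x, s)) * (n (x, s))\<^sup>2)
      - \<alpha>2 * (LINT s|lebesgue_on {0<..<t}. LINT x|?C. k (x, s) * \<omega> (x, s))" if t: "t \<in> {0<..<T}" for t
  proof -
    let ?J = "lebesgue_on {0<..<t}"
    let ?d = "\<lambda>s. LINT x|?C. \<nu>0 * (k (x, s) / \<omega> (x, s)) * (n (x, s))\<^sup>2"
    let ?w = "\<lambda>s. LINT x|?C. k (x, s) * \<omega> (x, s)"
    have sub: "integrable ?J h" if "integrable ?I h" for h :: "real \<Rightarrow> real"
      by (rule integrable_lebesgue_on_subset[OF that]) (use t in auto)
    have i: "integrable ?J ?d" "integrable ?J ?w" "integrable ?J (\<lambda>s. LINT x|?C. g (x, s))"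
      by (intro sub F(2) Di k\<omega>i gi)+
    \<comment> \<open>The spatial integral of \<open>g\<close> splits only where both parts have
      integrable slices, hence for almost every \<open>s\<close>.\<close>
    have "AE s in ?I. (LINT x|?C. g (x, s)) = ?d s - \<alpha>2 * ?w s"
      using F(1)[OF Di] F(1)[OF k\<omega>i]
      by eventually_elim (simp add: g_def mult.assoc)
    then have "AE s in ?J. (LINT x|?C. g (x, s)) = ?d s - \<alpha>2 * ?w s"
      using t by (auto simp: AE_restrict_space_iff elim!: eventually_mono)
    then have "G t = (LINT s|?J. ?d s - \<alpha>2 * ?w s)"
      unfolding G_def using i by (intro integral_cong_AE) auto
    then show ?thesis
      using i by simp
  qed

  have ksl: "AE t in ?I. integrable ?C (\<lambda>x. k (x, t))"
    by (rule F(1)[OF ki])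
  have "AE t in ?I. t \<in> {0<..<T}"
    by (auto simp: AE_restrict_space_iff)
  with gen usl ksl
  \<comment> \<open>Eliminating \<open>K t - K0\<close> by the total energy equality makes
    \<open>E t\<close> the right side minus the left side of the kinetic energy inequality
    \<open>gen\<close>.\<close>
  have EE: "AE t in ?I. E t \<ge> 0 \<and> (kinetic_energy_equality a T \<nu>0 f u0 u \<omega> k t \<longleftrightarrow> E t = 0)"
  proof eventually_elim
    fix t
    assume le: "(LINT x|?C. 1/2 * (norm (u (x, t)))\<^sup>2)
        + (LINT s|lebesgue_on {0<..<t}. LINT x|?C. \<nu>0 * (k (x, s) / \<omega> (x, s)) * (n (x, s))\<^sup>2)
        \<le> (LINT x|?C. 1/2 * (norm (u0 x))\<^sup>2)
          + (LINT s|lebesgue_on {0<..<t}. LINT x|?C. f (x, s) \<bullet> u (x, s))"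
      and ui: "integrable ?C (\<lambda>x. 1/2 * (norm (u (x, t)))\<^sup>2)"
      and ki: "integrable ?C (\<lambda>x. k (x, t))" and t: "t \<in> {0<..<T}"
    have "total_energy_equality a \<alpha>2 f u0 k0 u \<omega> k t"
      using assms(6) t by auto
    \<comment> \<open>Separating \<open>K t\<close> from the kinetic energy requires both slices at
      time \<open>t\<close> to be integrable, which \<open>usl\<close> and \<open>ksl\<close> give
      for almost every \<open>t\<close>.\<close>
    then have tot: "(LINT x|?C. 1/2 * (norm (u (x, t)))\<^sup>2) + K t
        + \<alpha>2 * (LINT s|lebesgue_on {0<..<t}. LINT x|?C. k (x, s) * \<omega> (x, s))
        = (LINT x|?C. 1/2 * (norm (u0 x))\<^sup>2) + K0
          + (LINT s|lebesgue_on {0<..<t}. LINT x|?C. f (x, s) \<bullet> u (x, s))"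
      unfolding total_energy_equality_def K_def K0_def
      using Bochner_Integration.integral_add[OF ui ki]
        Bochner_Integration.integral_add[OF integrable_mult_right[OF u0i, of "1/2"] k0i]
      by simp
    have kin: "kinetic_energy_equality a T \<nu>0 f u0 u \<omega> k t \<longleftrightarrow>
      (LINT x|?C. 1/2 * (norm (u (x, t)))\<^sup>2)
        + (LINT s|lebesgue_on {0<..<t}. LINT x|?C. \<nu>0 * (k (x, s) / \<omega> (x, s)) * (n (x, s))\<^sup>2)
        = (LINT x|?C. 1/2 * (norm (u0 x))\<^sup>2)
          + (LINT s|lebesgue_on {0<..<t}. LINT x|?C. f (x, s) \<bullet> u (x, s))"
      unfolding kinetic_energy_equality_def n_def by (simp only: mult.assoc integral_mult_right_zero)
    show "E t \<ge> 0 \<and> (kinetic_energy_equality a T \<nu>0 f u0 u \<omega> k t \<longleftrightarrow> E t = 0)"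
      unfolding kin E_def Gsplit[OF t] using tot le by (intro conjI iffI; linarith)
  qed

  have "(LINT z|\<mu>. T - snd z) = (LINT t|?I. E t)"
  proof -
    have inS: "z \<in> closure (cyl a T)" if "z \<in> cyl a T" for z
      using that closure_subset by blast
    note D = dt_time[OF assms(1,2) inS] grad_time[OF assms(1,2) inS]
    \<comment> \<open>The time derivative of the test function is -1, so the first term of the weak
      equation becomes the integral of \<open>k\<close>. The convection and diffusion terms vanish
      with the spatial gradient, and the initial value \<open>T\<close> yields
      \<open>T * K0\<close>.\<close>
    have "(LINT z|?Q. k z * dt a T (\<lambda>z. T - snd z) z) = (LINT z|?Q. - k z)"
      by (intro Bochner_Integration.integral_cong) (auto simp: D)
    moreover have "(LINT z|?Q. k z * (u z \<bullet> grad a T (\<lambda>z. T - snd z) z)) = (LINT z|?Q. 0)"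
      by (intro Bochner_Integration.integral_cong) (auto simp: D)
    moreover have "(LINT z|?Q. k z / \<omega> z * (sgrad a T k z \<bullet> grad a T (\<lambda>z. T - snd z) z)) = (LINT z|?Q. 0)"
      by (intro Bochner_Integration.integral_cong) (auto simp: D)
    ultimately have w: "(LINT z|?Q. k z) = T * K0 + (LINT z|?Q. g z * (T - snd z)) + (LINT z|\<mu>. T - snd z)"
      using weakk[OF C1_per_T_time[OF assms(1,2)]] by (simp add: K0_def g_def n_def)
    have "(\<lambda>z::space_time. snd z) \<in> borel_measurable lborel"
      by (simp add: borel_measurable_continuous_onI continuous_on_snd)
    then have [measurable]: "(\<lambda>z. snd z) \<in> borel_measurable ?Q"
      by (intro measurable_restrict_space1 measurable_completion)
    have [measurable]: "g \<in> borel_measurable ?Q"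
      using gi by simp
    have gTi: "integrable ?Q (\<lambda>z. g z * (T - snd z))"
    proof (rule Bochner_Integration.integrable_bound)
      show "integrable ?Q (\<lambda>z. T * g z)"
        using gi by simp
      show "AE z in ?Q. norm (g z * (T - snd z)) \<le> norm (T * g z)"
        by (rule AE_I2) (auto simp: cyl_def abs_mult mult.commute[of T] intro!: mult_left_mono)
    qed measurable
    have "(LINT z|?Q. g z * (T - snd z)) = (LINT t|?I. LINT x|?C. g (x, t) * (T - t))"
      using F(3)[OF gTi] by simp
    also have "\<dots> = (LINT t|?I. (T - t) * (LINT x|?C. g (x, t)))"
      by (simp add: mult.commute)
    \<comment> \<open>The weight \<open>T - t\<close> from the test function is exactly the one that
      \<open>integral_primitive\<close> produces when \<open>G\<close> is integrated over the whole
      time interval.\<close>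
    also have "\<dots> = (LINT t|?I. G t)"
      unfolding G_def by (rule integral_primitive(2)[OF F(2)[OF gi], symmetric])
    finally have gG: "(LINT z|?Q. g z * (T - snd z)) = (LINT t|?I. G t)" .
    have kK: "(LINT z|?Q. k z) = (LINT t|?I. K t)"
      unfolding K_def by (rule F(3)[OF ki, symmetric])
    have "(LINT t|?I. E t) = (LINT t|?I. K t) - (LINT t|?I. K0) - (LINT t|?I. G t)"
      unfolding E_def using Ki ci Gi by simp
    \<comment> \<open>The length \<open>T\<close> of the time interval equals the initial value of
      the test function, so the contributions of \<open>k0\<close> cancel.\<close>
    also have "(LINT t|?I. K0) = T * K0"
      using mI by simp
    finally show ?thesis
      using w gG kK by simp
  qed
  moreover have "(LINT t|?I. E t) = 0 \<longleftrightarrow> (AE t in ?I. E t = 0)"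
    using Ei by (rule integral_nonneg_eq_0_iff_AE) (use EE in auto)
  moreover have "(AE t in ?I. E t = 0) \<longleftrightarrow> (AE t in ?I. kinetic_energy_equality a T \<nu>0 f u0 u \<omega> k t)"
  proof
    assume "AE t in ?I. E t = 0"
    with EE show "AE t in ?I. kinetic_energy_equality a T \<nu>0 f u0 u \<omega> k t"
      by eventually_elim blast
  next
    assume "AE t in ?I. kinetic_energy_equality a T \<nu>0 f u0 u \<omega> k t"
    with EE show "AE t in ?I. E t = 0"
      by eventually_elim blast
  qed
  ultimately have main: "emeasure \<mu> (lower_part a T) = 0 \<longleftrightarrow>
      (AE t in lebesgue_on {0..T}. kinetic_energy_equality a T \<nu>0 f u0 u \<omega> k t)"
    using integral_time_measure_eq_0_iff[OF assms(2) rad] by (simp add: AE_lebesgue_on_Icc_iff_Ioo)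
  \<comment> \<open>The argument decides whether \<mu> charges \<open>t < T\<close>. When the top
    part is null, this is the same as \<mu> being the zero measure.\<close>
  show ?thesis
    using main eq_zero_measure_iff[OF assms(2) rad] by blast
qed

end
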